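(* For any infinite cardinal $\kappa$ and any group $G$ with $\mathrm{Alt}(\kappa)\subset G\subset\mathrm{Sym}(\kappa)$ (subgroups), one has $$\kappa=s_s(G)=u_c(G)=w_l(G)=cn(G).$$
   Context: Permutation groups: $\mathrm{Sym}(\kappa)$ is the group of all bijections $\kappa\to\kappa$ under composition; $\mathrm{Alt}(\kappa)$ is its subgroup of even permutations, i.e. those that are compositions of an even number of transpositions (a transposition is a permutation moving exactly two points). Topologies on a group $G$: A topology $\tau$ on $G$ is shift-invariant if for all $a,b\in G$ the map $x\mapsto axb$ is a homeomorphism of $(G,\tau)$ (equivalently, multiplication is separately continuous); $G$ with such a topology is a semitopological group. $\mathcal T_s(G)$ is the family of Hausdorff shift-invariant topologies on $G$. $\mathcal T_c(G)$ is the family of Hausdorff shift-invariant topologies on $G$ for which the commutator map $G\times G\to G$, $(x,y)\mapsto xyx^{-1}y^{-1}$, is separately continuous. A group topology is one for which $(x,y)\mapsto xy^{-1}$ is jointly continuous; it is linear if it has a neighborhood base at the unit $1_G$ consisting of open subgroups. $\mathcal T_l(G)$ is the family of linear Hausdorff group topologies on $G$. Cardinal functions of a semitopological group $(G,\tau)$: the weight $w(G,\tau)$ is the smallest cardinality of a base of $\tau$; the spread $s(G,\tau)$ is $\sup\{|D|: D\subset G \text{ is a discrete subspace of }(G,\tau)\}$; the uniform spread $u(G,\tau)$ is $\sup\{|D|: D\subset G\text{ is uniformly discrete in }(G,\tau)\}$, where $D$ is uniformly discrete if there is a $\tau$-open neighborhood $U$ of $1_G$ such that $y\notin xU$ for any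 distinct $x,y\in D$. Group invariants: $s_s(G)=\min\{s(G,\tau):\tau\in\mathcal T_s(G)\}$, $u_c(G)=\min\{u(G,\tau):\tau\in\mathcal T_c(G)\}$, $w_l(G)=\min\{w(G,\tau):\tau\in\mathcal T_l(G)\}$. The weak compatibility number $cn(G)$ is the smallest infinite cardinal $\mu$ such that $G$ satisfies the weak $\mu^+$-compatibility condition: for any finite group $F$ and any isomorphisms $f_i:F\to F_i$, $i<\mu^+$, onto finite subgroups $F_i$ of $G$, there are two indices $i<j<\mu^+$ and a homomorphism $\phi:\langle F_i\cup F_j\rangle\to F$ such that $\phi\circ f_i=\phi\circ f_j=\mathrm{id}_F$. Here $\mu^+$ is the successor cardinal of $\mu$ and $\langle A\rangle$ is the subgroup generated by $A$. *)

theory Defs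
  imports "HOL-Analysis.Analysis" "HOL-Algebra.Sym_Groups"
begin

unbundle cardinal_syntax

section \<open>Minima and suprema of cardinals\<close>

text \<open>
  Cardinals are represented by cardinal orders (\<^const>\<open>Card_order\<close>), and equality of cardinals
  is \<open>=o\<close>. Minima and suprema are therefore determined up to \<open>=o\<close>. The supremum of
  cardinals on a type exists among the cardinals on that type, because the cardinal of the whole
  type is an upper bound.
\<close>

definition Cmin :: "'c rel set \<Rightarrow> 'c rel" where
  "Cmin R = (SOME r. r \<in> R \<and> (\<forall>r'\<in>R. r \<le>o r'))"

definition Csup :: "'c rel set \<Rightarrow> 'c rel" where
  "Csup R = Cmin {r. Card_order r \<and> (\<forall>r'\<in>R. r' \<le>o r)}"

lemma Cmin_is_minimum:
  assumes "R \<noteq> {}" and "\<And>r. r \<in> R \<Longrightarrow> Card_order r"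
  shows "Cmin R \<in> R" and "\<And>r. r \<in> R \<Longrightarrow> Cmin R \<le>o r"
proof -
  have "\<forall>r\<in>R. Card_order r"
    using assms(2) ..
  with assms(1) have "\<exists>r\<in>R. \<forall>r'\<in>R. r \<le>o r'"
    by (rule exists_minim_Card_order)
  then have "\<exists>r. r \<in> R \<and> (\<forall>r'\<in>R. r \<le>o r')"
    unfolding Bex_def .
  then have *: "Cmin R \<in> R \<and> (\<forall>r'\<in>R. Cmin R \<le>o r')"
    unfolding Cmin_def by (rule someI_ex)
  show "Cmin R \<in> R"
    using * by (rule conjunct1)
  show "Cmin R \<le>o r" if "r \<in> R" for r
    using conjunct2[OF *] that by (rule bspec)
qed

lemma Csup_is_supremum:
  fixes R :: "'c rel set"
  assumes "\<And>r. r \<in> R \<Longrightarrow> Card_order r"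
  shows "Card_order (Csup R)" and "\<And>r. r \<in> R \<Longrightarrow> r \<le>o Csup R"
    and "\<And>r :: 'c rel. Card_order r \<Longrightarrow> (\<And>r'. r' \<in> R \<Longrightarrow> r' \<le>o r) \<Longrightarrow> Csup R \<le>o r"
proof -
  define U :: "'c rel set" where "U = {r. Card_order r \<and> (\<forall>r'\<in>R. r' \<le>o r)}"
  have U: "r \<in> U \<longleftrightarrow> Card_order r \<and> (\<forall>r'\<in>R. r' \<le>o r)" for r
    unfolding U_def by (rule mem_Collect_eq)
  have Csup: "Csup R = Cmin U"
    unfolding Csup_def U_def ..
  have card: "Card_order r" if "r \<in> U" for r
    using that unfolding U by (rule conjunct1)
  have "r \<le>o |UNIV :: 'c set|" if "r \<in> R" for r
    by (rule ordIso_ordLeq_trans[OF ordIso_symmetric[OF card_of_Field_ordIso[OF assms[OF that]]]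
          card_of_mono1[OF subset_UNIV]])
  then have "|UNIV :: 'c set| \<in> U"
    unfolding U by (intro conjI ballI card_of_Card_order)
  then have ne: "U \<noteq> {}"
    by (rule ex_in_conv[THEN iffD1, OF exI])
  have *: "Csup R \<in> U"
    unfolding Csup by (rule Cmin_is_minimum(1)[OF ne]) (rule card)
  show "Card_order (Csup R)"
    using * by (rule card)
  show "r \<le>o Csup R" if "r \<in> R" for r
    using * that unfolding U by (elim conjE bspec)
  show "Csup R \<le>o r" if "Card_order r" and "\<And>r'. r' \<in> R \<Longrightarrow> r' \<le>o r" for r :: "'c rel"
  proof -
    have "r \<in> U"
      unfolding U by (intro conjI ballI that)
    show ?thesis
      unfolding Csup by (rule Cmin_is_minimum(2)[OF ne _ \<open>r \<in> U\<close>]) (rule card)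
  qed
qed

section \<open>Permutation groups\<close>

text \<open>As for \<^const>\<open>sym_group\<close>, permutations of \<open>X\<close> are total functions that are the identity
  outside \<open>X\<close>.\<close>

definition Sym :: "'a set \<Rightarrow> ('a \<Rightarrow> 'a) monoid" where
  "Sym X = \<lparr>carrier = {p. p permutes X}, mult = (\<circ>), one = id\<rparr>"

definition Alt :: "'a set \<Rightarrow> ('a \<Rightarrow> 'a) set" where
  "Alt X = {apply_transps ts | ts.
              even (length ts) \<and> (\<forall>(a, b)\<in>set ts. a \<noteq> b \<and> a \<in> X \<and> b \<in> X)}"

lemma Alt_eq_evenperm: "Alt X = {p. p permutes X \<and> permutation p \<and> evenperm p}"
proof (intro equalityI subsetI)
  fix p assume "p \<in> Alt X"
  then obtain ts where p: "p = apply_transps ts" and "even (length ts)"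
    and ts: "\<forall>(a, b)\<in>set ts. a \<noteq> b \<and> a \<in> X \<and> b \<in> X"
    unfolding Alt_def by blast
  moreover from ts have "\<forall>(a, b)\<in>set ts. a \<noteq> b" and "\<forall>(a, b)\<in>set ts. a \<in> X \<and> b \<in> X"
    by auto
  ultimately show "p \<in> {p. p permutes X \<and> permutation p \<and> evenperm p}"
    by (simp add: evenperm_apply_transps_iff permutes_apply_transps)
next
  fix p assume "p \<in> {p. p permutes X \<and> permutation p \<and> evenperm p}"
  then have p: "p permutes X" "permutation p" "evenperm p"
    by auto
  let ?S = "{x. p x \<noteq> x}"
  have S: "?S \<subseteq> X" "finite ?S"
    using permutes_not_in[OF p(1)] permutation_finite_support[OF p(2)] by auto
  have pS: "p permutes ?S"
    using p(1) by (rule permutes_superset) auto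
  obtain ts where ts: "\<forall>(a, b)\<in>set ts. a \<noteq> b \<and> a \<in> ?S \<and> b \<in> ?S" "apply_transps ts = p"
    using permutes_from_transpositions[OF pS S(2)] by (elim exE conjE)
  have "\<forall>(a, b)\<in>set ts. a \<noteq> b"
    using ts(1) by auto
  then have "even (length ts)"
    using evenperm_apply_transps_iff[of ts] ts(2) p(3) by simp
  moreover have "\<forall>(a, b)\<in>set ts. a \<noteq> b \<and> a \<in> X \<and> b \<in> X"
    using ts(1) S(1) by auto
  ultimately show "p \<in> Alt X"
    unfolding Alt_def using ts(2) by auto
qed

section \<open>Topologies on groups\<close>

definition shift_invariant :: "('g, 'm) monoid_scheme \<Rightarrow> 'g topology \<Rightarrow> bool" where
  "shift_invariant G \<tau> \<longleftrightarrow> topspace \<tau> = carrier G \<and>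
     (\<forall>a\<in>carrier G. \<forall>b\<in>carrier G. homeomorphic_map \<tau> \<tau> (\<lambda>x. a \<otimes>\<^bsub>G\<^esub> x \<otimes>\<^bsub>G\<^esub> b))"

definition comm :: "('g, 'm) monoid_scheme \<Rightarrow> 'g \<Rightarrow> 'g \<Rightarrow> 'g" where
  "comm G x y = x \<otimes>\<^bsub>G\<^esub> y \<otimes>\<^bsub>G\<^esub> inv\<^bsub>G\<^esub> x \<otimes>\<^bsub>G\<^esub> inv\<^bsub>G\<^esub> y"

definition group_topology :: "('g, 'm) monoid_scheme \<Rightarrow> 'g topology \<Rightarrow> bool" where
  "group_topology G \<tau> \<longleftrightarrow> topspace \<tau> = carrier G \<and>
     continuous_map (prod_topology \<tau> \<tau>) \<tau> (\<lambda>(x, y). x \<otimes>\<^bsub>G\<^esub> inv\<^bsub>G\<^esub> y)"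

definition linear_topology :: "('g, 'm) monoid_scheme \<Rightarrow> 'g topology \<Rightarrow> bool" where
  "linear_topology G \<tau> \<longleftrightarrow>
     (\<forall>U. openin \<tau> U \<and> \<one>\<^bsub>G\<^esub> \<in> U \<longrightarrow> (\<exists>H. subgroup H G \<and> openin \<tau> H \<and> H \<subseteq> U))"

definition T_s :: "('g, 'm) monoid_scheme \<Rightarrow> 'g topology set" where
  "T_s G = {\<tau>. Hausdorff_space \<tau> \<and> shift_invariant G \<tau>}"

definition T_c :: "('g, 'm) monoid_scheme \<Rightarrow> 'g topology set" where
  "T_c G = {\<tau>. Hausdorff_space \<tau> \<and> shift_invariant G \<tau> \<and>
     (\<forall>a\<in>carrier G. continuous_map \<tau> \<tau> (\<lambda>x. comm G a x) \<and> continuous_map \<tau> \<tau> (\<lambda>x. comm G x a))}"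

definition T_l :: "('g, 'm) monoid_scheme \<Rightarrow> 'g topology set" where
  "T_l G = {\<tau>. Hausdorff_space \<tau> \<and> group_topology G \<tau> \<and> linear_topology G \<tau>}"

section \<open>Cardinal functions\<close>

definition is_base :: "'g topology \<Rightarrow> 'g set set \<Rightarrow> bool" where
  "is_base \<tau> B \<longleftrightarrow> (\<forall>V\<in>B. openin \<tau> V) \<and>
     (\<forall>U x. openin \<tau> U \<and> x \<in> U \<longrightarrow> (\<exists>V\<in>B. x \<in> V \<and> V \<subseteq> U))"

definition weight :: "'g topology \<Rightarrow> 'g set rel" where
  "weight \<tau> = Cmin {|B| | B. is_base \<tau> B}"

definition spread :: "'g topology \<Rightarrow> 'g rel" where
  "spread \<tau> = Csup {|D| | D. D \<subseteq> topspace \<tau> \<and> subtopology \<tau> D = discrete_topology D}"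

definition uniformly_discrete :: "('g, 'm) monoid_scheme \<Rightarrow> 'g topology \<Rightarrow> 'g set \<Rightarrow> bool" where
  "uniformly_discrete G \<tau> D \<longleftrightarrow>
     (\<exists>U. openin \<tau> U \<and> \<one>\<^bsub>G\<^esub> \<in> U \<and> (\<forall>x\<in>D. \<forall>y\<in>D. x \<noteq> y \<longrightarrow> y \<notin> x <#\<^bsub>G\<^esub> U))"

definition uniform_spread :: "('g, 'm) monoid_scheme \<Rightarrow> 'g topology \<Rightarrow> 'g rel" where
  "uniform_spread G \<tau> = Csup {|D| | D. D \<subseteq> carrier G \<and> uniformly_discrete G \<tau> D}"

section \<open>Group invariants\<close>

definition s_s :: "('g, 'm) monoid_scheme \<Rightarrow> 'g rel" where
  "s_s G = Cmin {spread \<tau> | \<tau>. \<tau> \<in> T_s G}"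

definition u_c :: "('g, 'm) monoid_scheme \<Rightarrow> 'g rel" where
  "u_c G = Cmin {uniform_spread G \<tau> | \<tau>. \<tau> \<in> T_c G}"

definition w_l :: "('g, 'm) monoid_scheme \<Rightarrow> 'g set rel" where
  "w_l G = Cmin {weight \<tau> | \<tau>. \<tau> \<in> T_l G}"

text \<open>
  In the following definition \<open>r\<close> is the cardinal whose elements index the isomorphisms, and the
  strict order \<open>i < j\<close> is the one of \<open>r\<close>. Every finite group is isomorphic to one whose elements are
  natural numbers; \<open>weakly_compatibleD\<close> below gives the condition for finite groups over any type.
\<close>

definition weakly_compatible :: "('g, 'm) monoid_scheme \<Rightarrow> 'i rel \<Rightarrow> bool" where
  "weakly_compatible G r \<longleftrightarrow>
     (\<forall>(F :: nat monoid) E f.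
        group F \<and> finite (carrier F) \<and>
        (\<forall>i\<in>Field r. subgroup (E i) G \<and> finite (E i) \<and> f i \<in> iso F (G\<lparr>carrier := E i\<rparr>)) \<longrightarrow>
        (\<exists>i\<in>Field r. \<exists>j\<in>Field r. (i, j) \<in> r \<and> i \<noteq> j \<and>
           (\<exists>\<phi>\<in>hom (G\<lparr>carrier := generate G (E i \<union> E j)\<rparr>) F.
              \<forall>x\<in>carrier F. \<phi> (f i x) = x \<and> \<phi> (f j x) = x)))"

lemma weakly_compatibleD:
  fixes F :: "('h, 'n) monoid_scheme"
  assumes wc: "weakly_compatible G r" and F: "group F" "finite (carrier F)"
    and f: "\<And>i. i \<in> Field r \<Longrightarrow> subgroup (E i) G \<and> finite (E i) \<and> f i \<in> iso F (G\<lparr>carrier := E i\<rparr>)"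
  shows "\<exists>i\<in>Field r. \<exists>j\<in>Field r. (i, j) \<in> r \<and> i \<noteq> j \<and>
           (\<exists>\<phi>\<in>hom (G\<lparr>carrier := generate G (E i \<union> E j)\<rparr>) F.
              \<forall>x\<in>carrier F. \<phi> (f i x) = x \<and> \<phi> (f j x) = x)"
proof -
  interpret F: group F by (rule F(1))
  obtain e :: "nat \<Rightarrow> 'h" and n where e: "bij_betw e {..<n} (carrier F)"
    using ex_bij_betw_nat_finite[OF F(2)] by (auto simp: atLeast0LessThan)
  define d where "d = inv_into {..<n} e"
  have d: "bij_betw d (carrier F) {..<n}"
    unfolding d_def by (rule bij_betw_inv_into[OF e])
  have ed: "e (d x) = x" if "x \<in> carrier F" for x
    using e that unfolding d_def by (metis bij_betw_inv_into_right)
  have de: "d (e k) = k" if "k < n" for k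
    using e that unfolding d_def by (meson bij_betw_inv_into_left lessThan_iff)
  have ec: "e k \<in> carrier F" if "k < n" for k
    using e that by (auto dest: bij_betwE)
  have dn: "d x < n" if "x \<in> carrier F" for x
    using d that by (auto dest: bij_betwE)
  define N :: "nat monoid" where
    "N = \<lparr>carrier = {..<n}, mult = (\<lambda>x y. d (e x \<otimes>\<^bsub>F\<^esub> e y)), one = d \<one>\<^bsub>F\<^esub>\<rparr>"
  have gN: "group N"
  proof (rule groupI)
    show "\<exists>y\<in>carrier N. y \<otimes>\<^bsub>N\<^esub> x = \<one>\<^bsub>N\<^esub>" if "x \<in> carrier N" for x
      using that by (intro bexI[of _ "d (inv\<^bsub>F\<^esub> (e x))"]) (auto simp: N_def ed de ec dn)
  qed (auto simp: N_def ed de ec dn F.m_assoc)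
  have e_iso: "e \<in> iso N F"
    unfolding iso_def hom_def using e by (auto simp: N_def ed ec)
  have d_hom: "d \<in> hom F N"
    unfolding hom_def by (auto simp: N_def ed dn)
  have "f i \<circ> e \<in> iso N (G\<lparr>carrier := E i\<rparr>)" if "i \<in> Field r" for i
    using iso_set_trans[OF e_iso] f[OF that] by (auto simp: comp_def)
  then obtain i j \<phi> where ij: "i \<in> Field r" "j \<in> Field r" "(i, j) \<in> r" "i \<noteq> j"
    and \<phi>: "\<phi> \<in> hom (G\<lparr>carrier := generate G (E i \<union> E j)\<rparr>) N"
      "\<And>x. x \<in> carrier N \<Longrightarrow> \<phi> (f i (e x)) = x \<and> \<phi> (f j (e x)) = x"
    using wc[unfolded weakly_compatible_def, rule_format, of N E "\<lambda>i. f i \<circ> e"] f gN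
    by (auto simp: N_def)
  have "e \<circ> \<phi> \<in> hom (G\<lparr>carrier := generate G (E i \<union> E j)\<rparr>) F"
    using \<phi>(1) e_iso by (meson hom_compose iso_imp_homomorphism)
  moreover have "(e \<circ> \<phi>) (f i x) = x \<and> (e \<circ> \<phi>) (f j x) = x" if "x \<in> carrier F" for x
    using \<phi>(2)[of "d x"] that by (auto simp: N_def ed dn)
  ultimately show ?thesis
    using ij by blast
qed

text \<open>
  The condition for the successor of \<open>\<mu>\<close> holds for every infinite \<open>\<mu>\<close> with \<open>|G| \<le> \<mu>\<close>: there are at
  most \<open>\<mu>\<close> maps from a finite \<open>F\<close> to \<open>G\<close>, so two of the isomorphisms coincide. Hence the least infinite \<open>\<mu>\<close> occurs among
  the cardinals on the type \<^typ>\<open>'g + nat\<close>, also if \<open>G\<close> is finite.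
\<close>

definition cn :: "('g, 'm) monoid_scheme \<Rightarrow> ('g + nat) rel" where
  "cn G = Cmin {\<mu>. Cinfinite \<mu> \<and> weakly_compatible G (cardSuc \<mu>)}"

end

theory Submission
  imports Defs "HOL-Algebra.Free_Abelian_Groups"
begin

text \<open>
  Write \<open>X\<close> for the field of \<open>\<kappa>\<close>. All lower bounds come from one family of \<open>\<kappa>\<close> many even permutations,
  the three-cycles \<open>d\<^sub>i = (p q i)\<close> with fixed \<open>p\<close>, \<open>q\<close> and \<open>i\<close> varying outside a finite set; all upper
  bounds come from the action on finite subsets of \<open>X\<close>, which also defines the topology of
  pointwise convergence.

  \<^item> In a Hausdorff shift-invariant topology the set of all \<open>x\<close> with \<open>x b \<noteq> b x\<close> is open. For
    \<open>b = (i v w)\<close> it contains \<open>d\<^sub>i\<close>, but no \<open>d\<^sub>j\<close> with \<open>j \<noteq> i\<close>, because then \<open>b\<close> and \<open>d\<^sub>j\<close> have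
    disjoint supports. So the family is discrete (\<open>D_discrete\<close>).

  \<^item> If the commutator map is separately continuous, then so is \<open>x \<mapsto> x b x\<inverse>\<close>, and the set of all \<open>x\<close>
    for which \<open>x b x\<inverse>\<close> does not commute with \<open>a\<close> is open; it is a neighbourhood of the unit if \<open>a\<close>
    and \<open>b\<close> do not commute. For three-cycles \<open>a\<close> and \<open>b\<close> whose supports meet only in \<open>q\<close> and
    do not contain \<open>i\<close> and \<open>j\<close>, the quotient of \<open>d\<^sub>i\<close> and \<open>d\<^sub>j\<close>, which is \<open>(q j i)\<close>, moves the support of \<open>b\<close> off that of
    \<open>a\<close> and so lies outside this neighbourhood. So the family is uniformly discrete
    (\<open>D_uniformly_discrete\<close>).

  \<^item> No homomorphism to \<open>\<int>/3\<close> sends \<open>d\<^sub>i\<close> and \<open>d\<^sub>j\<close> both to \<open>1\<close>, because \<open>d\<^sub>i d\<^sub>j\<close> is an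
    involution and \<open>4 \<noteq> 0\<close> in \<open>\<int>/3\<close>. So the cyclic groups generated by the \<open>d\<^sub>i\<close>
    violate weak compatibility for every cardinal up to \<open>\<kappa>\<close> (\<open>not_weakly_compatible_below\<close>).

  \<^item> The topology of pointwise convergence is a linear Hausdorff group topology with a base indexed
    by finite partial maps on \<open>X\<close>, of which there are \<open>\<kappa>\<close> many (\<open>small_base_pointwise\<close>). The size of a
    discrete subspace is at most that of a base, and a uniformly discrete set is a discrete
    subspace; this bounds both spreads from above, and bounds weights from below by the spread.

  \<^item> A finite subgroup of \<open>G\<close> acts faithfully on some finite invariant subset of \<open>X\<close>. There are only
    \<open>\<kappa>\<close> many finite actions on finite subsets of \<open>X\<close>, so among more than \<open>\<kappa>\<close> isomorphic finite
    subgroups two act in the same way on the same set; restriction to that set yields the homomorphism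
    required by weak compatibility (\<open>weakly_compatible_above\<close>).
\<close>

section \<open>Bounds for minima and suprema of cardinals\<close>

lemma Cmin_ordIso:
  fixes \<kappa> :: "'b rel" and R :: "'c rel set"
  assumes "\<And>r. r \<in> R \<Longrightarrow> Card_order r" and "\<And>r. r \<in> R \<Longrightarrow> \<kappa> \<le>o r"
    and "r\<^sub>0 \<in> R" and "r\<^sub>0 \<le>o \<kappa>"
  shows "\<kappa> =o Cmin R"
proof -
  have "R \<noteq> {}" using assms(3) by auto
  from Cmin_is_minimum[OF this assms(1)]
  have "Cmin R \<in> R" "Cmin R \<le>o r\<^sub>0" using assms(3) by auto
  then show ?thesis
    using assms(2,4) by (meson ordIso_iff_ordLeq ordLeq_transitive)
qed

text \<open>
  \<^const>\<open>Csup\<close> is a least upper bound only among the cardinals on its own type. The set \<open>D\<^sub>0\<close>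
  transports the bound \<open>\<kappa>\<close>, which may live on another type, to that type.
\<close>

lemma Csup_card_ordLeq:
  fixes \<kappa> :: "'b rel" and \<D> :: "'c set set"
  assumes "D\<^sub>0 \<in> \<D>" and "|D\<^sub>0| =o \<kappa>" and "\<And>D. D \<in> \<D> \<Longrightarrow> |D| \<le>o \<kappa>"
  shows "Csup {|D| | D. D \<in> \<D>} \<le>o \<kappa>"
proof -
  have "Csup {|D| | D. D \<in> \<D>} \<le>o |D\<^sub>0|"
  proof (rule Csup_is_supremum(3))
    fix r assume "r \<in> {|D| | D. D \<in> \<D>}"
    then show "r \<le>o |D\<^sub>0|"
      using assms(2,3) by (auto intro: ordLeq_ordIso_trans ordIso_symmetric)
  qed (auto simp: card_of_Card_order)
  then show ?thesis
    using assms(2) by (rule ordLeq_ordIso_trans)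
qed

lemma ordLeq_Csup_card:
  fixes \<D> :: "'c set set"
  assumes "D \<in> \<D>"
  shows "|D| \<le>o Csup {|D| | D. D \<in> \<D>}"
  using assms by (intro Csup_is_supremum(2)) (auto simp: card_of_Card_order)

lemma Card_order_Csup_card: "Card_order (Csup {|D| | D. D \<in> \<D>})"
  by (intro Csup_is_supremum(1)) (auto simp: card_of_Card_order)

lemma card_of_Fpow_ordLeq:
  assumes "infinite B" and "|A| \<le>o |B|"
  shows "|Fpow A| \<le>o |B|"
proof -
  have "|Fpow A| \<le>o |Fpow B|"
    using assms(2) by (rule card_of_Fpow_mono)
  then show ?thesis
    using card_of_Fpow_infinite[OF assms(1)] by (rule ordLeq_ordIso_trans)
qed

section \<open>Discrete sets in semitopological groups\<close>

lemma discrete_subspace_iff: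
  assumes "D \<subseteq> topspace \<tau>"
  shows "subtopology \<tau> D = discrete_topology D \<longleftrightarrow> (\<forall>d\<in>D. \<exists>U. openin \<tau> U \<and> U \<inter> D = {d})"
proof -
  have "subtopology \<tau> D = discrete_topology D \<longleftrightarrow> (\<forall>d\<in>D. openin (subtopology \<tau> D) {d})"
    using assms discrete_topology_unique[of D "subtopology \<tau> D"] by (auto simp: eq_commute)
  then show ?thesis
    by (auto simp: openin_subtopology eq_commute)
qed

text \<open>
  Isolating the points of \<open>D\<close> by members of the base is an injection of \<open>D\<close> into the base.
\<close>

lemma discrete_subspace_ordLeq_base:
  assumes B: "is_base \<tau> B" and D: "D \<subseteq> topspace \<tau>" "subtopology \<tau> D = discrete_topology D"
  shows "|D| \<le>o |B|"
proof -
  have "\<exists>V\<in>B. V \<inter> D = {d}" if d: "d \<in> D" for d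
  proof -
    from D d obtain U where U: "openin \<tau> U" "U \<inter> D = {d}"
      unfolding discrete_subspace_iff[OF D(1)] by blast
    then have "d \<in> U" by auto
    with U(1) B have "\<exists>V\<in>B. d \<in> V \<and> V \<subseteq> U"
      by (simp add: is_base_def)
    with U(2) d show ?thesis by auto
  qed
  then obtain V where V: "\<And>d. d \<in> D \<Longrightarrow> V d \<in> B \<and> V d \<inter> D = {d}"
    by metis
  then have "inj_on V D"
    by (metis inj_onI singleton_inject)
  then show ?thesis
    using V by (auto intro: card_of_ordLeqI)
qed

lemma continuous_shift:
  assumes "group G" "shift_invariant G \<tau>" "a \<in> carrier G" "continuous_map \<tau> \<tau> f"
  shows "continuous_map \<tau> \<tau> (\<lambda>x. a \<otimes>\<^bsub>G\<^esub> f x)" "continuous_map \<tau> \<tau> (\<lambda>x. f x \<otimes>\<^bsub>G\<^esub> a)"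
proof -
  interpret group G by fact
  have top: "topspace \<tau> = carrier G"
    using assms(2) by (simp add: shift_invariant_def)
  have f: "f x \<in> carrier G" if "x \<in> carrier G" for x
    using continuous_map_image_subset_topspace[OF assms(4)] that top by auto
  have "continuous_map \<tau> \<tau> ((\<lambda>x. b \<otimes>\<^bsub>G\<^esub> x \<otimes>\<^bsub>G\<^esub> c) \<circ> f)" if "b \<in> carrier G" "c \<in> carrier G" for b c
    using assms(2,4) that
    by (intro continuous_map_compose[OF assms(4)] homeomorphic_imp_continuous_map)
      (simp add: shift_invariant_def)
  note * = this
  show "continuous_map \<tau> \<tau> (\<lambda>x. a \<otimes>\<^bsub>G\<^esub> f x)"
    using assms(3) f by (intro continuous_map_eq[OF *[of a "\<one>\<^bsub>G\<^esub>"]]) (simp_all add: top)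
  show "continuous_map \<tau> \<tau> (\<lambda>x. f x \<otimes>\<^bsub>G\<^esub> a)"
    using assms(3) f by (intro continuous_map_eq[OF *[of "\<one>\<^bsub>G\<^esub>" a]]) (simp_all add: top)
qed

lemma openin_neq:
  assumes "Hausdorff_space \<tau>" "continuous_map \<tau> \<tau> f" "continuous_map \<tau> \<tau> g"
  shows "openin \<tau> {x \<in> topspace \<tau>. f x \<noteq> g x}"
proof -
  have "{x \<in> topspace \<tau>. f x \<noteq> g x} = topspace \<tau> - {x \<in> topspace \<tau>. f x = g x}"
    by auto
  then show ?thesis
    using closedin_continuous_maps_eq[OF assms] by (metis openin_diff openin_topspace)
qed

lemma openin_not_commuting:
  assumes "group G" "\<tau> \<in> T_s G" "b \<in> carrier G"
  shows "openin \<tau> {x \<in> carrier G. x \<otimes>\<^bsub>G\<^esub> b \<noteq> b \<otimes>\<^bsub>G\<^esub> x}"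
proof -
  have \<tau>: "Hausdorff_space \<tau>" "shift_invariant G \<tau>" "topspace \<tau> = carrier G"
    using assms(2) by (auto simp: T_s_def shift_invariant_def)
  show ?thesis
    using openin_neq[OF \<tau>(1) continuous_shift(2,1)[OF assms(1) \<tau>(2) assms(3), of "\<lambda>x. x"]] \<tau>(3)
    by simp
qed

text \<open>
  Conjugation \<open>x \<mapsto> x b x\<inverse>\<close> is continuous although inversion need not be: it is the commutator of
  \<open>x\<close> and \<open>b\<close>, multiplied by \<open>b\<close>.
\<close>

lemma openin_conjugate_not_commuting:
  assumes "group G" "\<tau> \<in> T_c G" "a \<in> carrier G" "b \<in> carrier G"
  shows "openin \<tau> {x \<in> carrier G. x \<otimes>\<^bsub>G\<^esub> b \<otimes>\<^bsub>G\<^esub> inv\<^bsub>G\<^esub> x \<otimes>\<^bsub>G\<^esub> a \<noteq> a \<otimes>\<^bsub>G\<^esub> (x \<otimes>\<^bsub>G\<^esub> b \<otimes>\<^bsub>G\<^esub> inv\<^bsub>G\<^esub> x)}"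
proof -
  interpret group G by fact
  have \<tau>: "Hausdorff_space \<tau>" "shift_invariant G \<tau>" "topspace \<tau> = carrier G"
    "continuous_map \<tau> \<tau> (\<lambda>x. comm G x b)"
    using assms(2,4) by (auto simp: T_c_def shift_invariant_def)
  have "comm G x b \<otimes>\<^bsub>G\<^esub> b = x \<otimes>\<^bsub>G\<^esub> b \<otimes>\<^bsub>G\<^esub> inv\<^bsub>G\<^esub> x" if "x \<in> carrier G" for x
    using that assms(4) by (simp add: comm_def m_assoc)
  then have "continuous_map \<tau> \<tau> (\<lambda>x. x \<otimes>\<^bsub>G\<^esub> b \<otimes>\<^bsub>G\<^esub> inv\<^bsub>G\<^esub> x)"
    by (intro continuous_map_eq[OF continuous_shift(2)[OF assms(1) \<tau>(2) assms(4) \<tau>(4)]])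
      (simp add: \<tau>(3))
  from openin_neq[OF \<tau>(1) continuous_shift(2,1)[OF assms(1) \<tau>(2) assms(3) this]] \<tau>(3)
  show ?thesis by simp
qed

text \<open>
  The translates of one witnessing neighbourhood of the unit isolate the points.
\<close>

lemma uniformly_discrete_imp_discrete:
  assumes "group G" "shift_invariant G \<tau>" "D \<subseteq> carrier G" "uniformly_discrete G \<tau> D"
  shows "subtopology \<tau> D = discrete_topology D"
proof -
  interpret group G by fact
  have top: "topspace \<tau> = carrier G"
    using assms(2) by (simp add: shift_invariant_def)
  obtain U where U: "openin \<tau> U" "\<one>\<^bsub>G\<^esub> \<in> U"
    "\<And>x y. x \<in> D \<Longrightarrow> y \<in> D \<Longrightarrow> x \<noteq> y \<Longrightarrow> y \<notin> x <#\<^bsub>G\<^esub> U"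
    using assms(4) unfolding uniformly_discrete_def by blast
  have "openin \<tau> (x <#\<^bsub>G\<^esub> U) \<and> (x <#\<^bsub>G\<^esub> U) \<inter> D = {x}" if x: "x \<in> D" for x
  proof
    have xG: "x \<in> carrier G" using x assms(3) by blast
    have "homeomorphic_map \<tau> \<tau> (\<lambda>y. x \<otimes>\<^bsub>G\<^esub> y \<otimes>\<^bsub>G\<^esub> \<one>\<^bsub>G\<^esub>)"
      using assms(2) xG by (simp add: shift_invariant_def)
    then have "openin \<tau> ((\<lambda>y. x \<otimes>\<^bsub>G\<^esub> y \<otimes>\<^bsub>G\<^esub> \<one>\<^bsub>G\<^esub>) ` U)"
      using U(1) by (meson homeomorphic_map_openness_eq)
    moreover have "(\<lambda>y. x \<otimes>\<^bsub>G\<^esub> y \<otimes>\<^bsub>G\<^esub> \<one>\<^bsub>G\<^esub>) ` U = x <#\<^bsub>G\<^esub> U"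
      using openin_subset[OF U(1)] xG top by (force simp: l_coset_def)
    ultimately show "openin \<tau> (x <#\<^bsub>G\<^esub> U)" by simp
    have "x \<in> x <#\<^bsub>G\<^esub> U"
      using U(2) xG by (force simp: l_coset_def)
    then show "(x <#\<^bsub>G\<^esub> U) \<inter> D = {x}"
      using U(3) x by blast
  qed
  then show ?thesis
    using assms(3) top by (subst discrete_subspace_iff) auto
qed

lemma T_c_subset_T_s: "T_c G \<subseteq> T_s G"
  by (auto simp: T_c_def T_s_def)

lemma T_l_subset_T_c:
  assumes "group G"
  shows "T_l G \<subseteq> T_c G"
proof
  interpret group G by fact
  fix \<tau> assume "\<tau> \<in> T_l G"
  then have H: "Hausdorff_space \<tau>" and top: "topspace \<tau> = carrier G"
    and div: "continuous_map (prod_topology \<tau> \<tau>) \<tau> (\<lambda>(x, y). x \<otimes>\<^bsub>G\<^esub> inv\<^bsub>G\<^esub> y)"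
    by (auto simp: T_l_def group_topology_def)
  have divide: "continuous_map \<tau> \<tau> (\<lambda>x. f x \<otimes>\<^bsub>G\<^esub> inv\<^bsub>G\<^esub> g x)"
    if "continuous_map \<tau> \<tau> f" "continuous_map \<tau> \<tau> g" for f g
    using continuous_map_compose[OF continuous_map_pairedI[OF that] div] by (simp add: comp_def)
  have const: "continuous_map \<tau> \<tau> (\<lambda>x. a)" if "a \<in> carrier G" for a
    using that top by simp
  have closed: "f x \<in> carrier G" if "continuous_map \<tau> \<tau> f" "x \<in> carrier G" for f x
    using continuous_map_image_subset_topspace[OF that(1)] that(2) top by auto
  have inverse: "continuous_map \<tau> \<tau> (\<lambda>x. inv\<^bsub>G\<^esub> f x)" if "continuous_map \<tau> \<tau> f" for f
    using closed[OF that]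
    by (intro continuous_map_eq[OF divide[OF const[OF one_closed] that]]) (simp add: top)
  have mult: "continuous_map \<tau> \<tau> (\<lambda>x. f x \<otimes>\<^bsub>G\<^esub> g x)"
    if "continuous_map \<tau> \<tau> f" "continuous_map \<tau> \<tau> g" for f g
    using closed[OF that(2)]
    by (intro continuous_map_eq[OF divide[OF that(1) inverse[OF that(2)]]]) (simp add: top)
  have cancel: "inv\<^bsub>G\<^esub> a \<otimes>\<^bsub>G\<^esub> (a \<otimes>\<^bsub>G\<^esub> x) = x" "a \<otimes>\<^bsub>G\<^esub> (inv\<^bsub>G\<^esub> a \<otimes>\<^bsub>G\<^esub> x) = x"
    if "a \<in> carrier G" "x \<in> carrier G" for a x
    using that by (simp_all flip: m_assoc)
  have "homeomorphic_map \<tau> \<tau> (\<lambda>x. a \<otimes>\<^bsub>G\<^esub> x \<otimes>\<^bsub>G\<^esub> b)" if "a \<in> carrier G" "b \<in> carrier G" for a b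
    unfolding homeomorphic_map_maps homeomorphic_maps_def
  proof (intro exI[of _ "\<lambda>x. inv\<^bsub>G\<^esub> a \<otimes>\<^bsub>G\<^esub> x \<otimes>\<^bsub>G\<^esub> inv\<^bsub>G\<^esub> b"] conjI ballI)
    show "continuous_map \<tau> \<tau> (\<lambda>x. a \<otimes>\<^bsub>G\<^esub> x \<otimes>\<^bsub>G\<^esub> b)"
      using that by (intro mult const continuous_map_id[unfolded id_def]) auto
    show "continuous_map \<tau> \<tau> (\<lambda>x. inv\<^bsub>G\<^esub> a \<otimes>\<^bsub>G\<^esub> x \<otimes>\<^bsub>G\<^esub> inv\<^bsub>G\<^esub> b)"
      using that by (intro mult const continuous_map_id[unfolded id_def]) auto
  qed (use that in \<open>simp_all add: top m_assoc cancel\<close>)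
  moreover have "continuous_map \<tau> \<tau> (\<lambda>x. comm G a x)" "continuous_map \<tau> \<tau> (\<lambda>x. comm G x a)"
    if "a \<in> carrier G" for a
    unfolding comm_def using that
    by (intro mult inverse const continuous_map_id[unfolded id_def]; simp)+
  ultimately show "\<tau> \<in> T_c G"
    using H top by (simp add: T_c_def shift_invariant_def)
qed

section \<open>The topology of pointwise convergence\<close>

lemma Sym_simps [simp]:
  "carrier (Sym X) = {p. p permutes X}" "mult (Sym X) = (\<circ>)" "one (Sym X) = id"
  by (simp_all add: Sym_def)

lemma group_Sym: "group (Sym X)"
proof (rule groupI)
  show "\<exists>y\<in>carrier (Sym X). y \<otimes>\<^bsub>Sym X\<^esub> p = \<one>\<^bsub>Sym X\<^esub>" if "p \<in> carrier (Sym X)" for p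
    using that by (intro bexI[of _ "inv' p"]) (auto simp: Sym_def permutes_inv permutes_inv_o)
qed (auto simp: Sym_def permutes_compose permutes_id comp_assoc)

locale permutation_group =
  fixes X :: "'a set" and H :: "('a \<Rightarrow> 'a) set"
  assumes subgroup_H: "subgroup H (Sym X)"
begin

abbreviation G where "G \<equiv> (Sym X)\<lparr>carrier := H\<rparr>"

sublocale group G
  by (rule group.subgroup_imp_group[OF group_Sym subgroup_H])

lemma carrier_G [simp]: "carrier G = H"
  and mult_G [simp]: "mult G = (\<circ>)"
  and one_G [simp]: "one G = id"
  by (simp_all add: Sym_simps)

lemma permutes: "g \<in> H \<Longrightarrow> g permutes X"
  using subgroup.subset[OF subgroup_H] by (auto simp: Sym_def)

lemma inv_G_apply:
  assumes "g \<in> H"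
  shows "(inv\<^bsub>G\<^esub> g) (g x) = x" "g ((inv\<^bsub>G\<^esub> g) x) = x"
  using assms l_inv[of g] r_inv[of g] by (simp_all add: fun_eq_iff)

definition pointwise_open :: "('a \<Rightarrow> 'a) set \<Rightarrow> bool" where
  "pointwise_open U \<longleftrightarrow>
     U \<subseteq> H \<and> (\<forall>g\<in>U. \<exists>A. finite A \<and> {h \<in> H. \<forall>a\<in>A. h a = g a} \<subseteq> U)"

definition pointwise :: "('a \<Rightarrow> 'a) topology" where
  "pointwise = topology pointwise_open"

lemma istopology_pointwise_open: "istopology pointwise_open"
  unfolding istopology_def
proof (intro conjI allI impI)
  fix S T assume S: "pointwise_open S" and T: "pointwise_open T"
  show "pointwise_open (S \<inter> T)"
    unfolding pointwise_open_def
  proof (intro conjI ballI)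
    show "S \<inter> T \<subseteq> H" using S unfolding pointwise_open_def by blast
    fix g assume g: "g \<in> S \<inter> T"
    obtain A where A: "finite A" "{h \<in> H. \<forall>a\<in>A. h a = g a} \<subseteq> S"
      using S g unfolding pointwise_open_def by blast
    obtain B where B: "finite B" "{h \<in> H. \<forall>a\<in>B. h a = g a} \<subseteq> T"
      using T g unfolding pointwise_open_def by blast
    have "{h \<in> H. \<forall>a\<in>A \<union> B. h a = g a} \<subseteq> S \<inter> T"
      using A(2) B(2) by blast
    with A(1) B(1) show "\<exists>A. finite A \<and> {h \<in> H. \<forall>a\<in>A. h a = g a} \<subseteq> S \<inter> T"
      by (meson finite_UnI)
  qed
next
  fix \<K> assume \<K>: "\<forall>K\<in>\<K>. pointwise_open K"
  show "pointwise_open (\<Union>\<K>)"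
    unfolding pointwise_open_def
  proof (intro conjI ballI)
    show "\<Union>\<K> \<subseteq> H" using \<K> unfolding pointwise_open_def by blast
    fix g assume "g \<in> \<Union>\<K>"
    then obtain K where K: "K \<in> \<K>" "g \<in> K" by blast
    with \<K> have "\<exists>A. finite A \<and> {h \<in> H. \<forall>a\<in>A. h a = g a} \<subseteq> K"
      unfolding pointwise_open_def by simp
    with K(1) show "\<exists>A. finite A \<and> {h \<in> H. \<forall>a\<in>A. h a = g a} \<subseteq> \<Union>\<K>"
      by (meson Sup_upper order_trans)
  qed
qed

lemma openin_pointwise:
  "openin pointwise U \<longleftrightarrow>
     U \<subseteq> H \<and> (\<forall>g\<in>U. \<exists>A. finite A \<and> {h \<in> H. \<forall>a\<in>A. h a = g a} \<subseteq> U)"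
  by (simp add: pointwise_def istopology_pointwise_open pointwise_open_def)

lemma openin_pointwise_agreeing:
  assumes "finite A"
  shows "openin pointwise {h \<in> H. \<forall>a\<in>A. h a = f a}"
  using assms by (auto simp: openin_pointwise intro!: exI[of _ A])

lemma topspace_pointwise [simp]: "topspace pointwise = H"
proof
  show "topspace pointwise \<subseteq> H"
    using openin_topspace[of pointwise] unfolding openin_pointwise by blast
  show "H \<subseteq> topspace pointwise"
    by (rule openin_subset) (auto simp: openin_pointwise)
qed

lemma pointwise_in_T_l: "pointwise \<in> T_l G"
proof -
  have "Hausdorff_space pointwise"
    unfolding Hausdorff_space_def
  proof (intro allI impI)
    fix g h assume "g \<in> topspace pointwise \<and> h \<in> topspace pointwise \<and> g \<noteq> h"
    then obtain a where "g \<in> H" "h \<in> H" "g a \<noteq> h a" by auto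
    then show "\<exists>U V. openin pointwise U \<and> openin pointwise V \<and> g \<in> U \<and> h \<in> V \<and> disjnt U V"
      using openin_pointwise_agreeing[of "{a}" g] openin_pointwise_agreeing[of "{a}" h]
      by (intro exI[of _ "{k \<in> H. \<forall>x\<in>{a}. k x = g x}"] exI[of _ "{k \<in> H. \<forall>x\<in>{a}. k x = h x}"])
        (auto simp: disjnt_iff)
  qed
  moreover have "continuous_map (prod_topology pointwise pointwise) pointwise
      (\<lambda>(x, y). x \<otimes>\<^bsub>G\<^esub> inv\<^bsub>G\<^esub> y)"
    unfolding continuous_map_def
  proof (intro conjI allI impI)
    show "(\<lambda>(x, y). x \<otimes>\<^bsub>G\<^esub> inv\<^bsub>G\<^esub> y) \<in> topspace (prod_topology pointwise pointwise) \<rightarrow> topspace pointwise"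
      using m_closed inv_closed by auto
    fix U assume U: "openin pointwise U"
    show "openin (prod_topology pointwise pointwise)
        {z \<in> topspace (prod_topology pointwise pointwise). (case z of (x, y) \<Rightarrow> x \<otimes>\<^bsub>G\<^esub> inv\<^bsub>G\<^esub> y) \<in> U}"
      unfolding openin_prod_topology_alt
    proof (intro allI impI)
      fix x y
      assume "(x, y) \<in> {z \<in> topspace (prod_topology pointwise pointwise).
        (case z of (x, y) \<Rightarrow> x \<otimes>\<^bsub>G\<^esub> inv\<^bsub>G\<^esub> y) \<in> U}"
      then have xy: "x \<in> H" "y \<in> H" "x \<circ> inv\<^bsub>G\<^esub> y \<in> U" by auto
      with U obtain A where A: "finite A" "{h \<in> H. \<forall>a\<in>A. h a = (x \<circ> inv\<^bsub>G\<^esub> y) a} \<subseteq> U"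
        unfolding openin_pointwise by blast
      \<comment> \<open>On \<open>A\<close> the product \<open>x y\<inverse>\<close> depends only on the values of \<open>x\<close> and \<open>y\<close> on \<open>y\<inverse>(A)\<close>.\<close>
      define B where "B = (inv\<^bsub>G\<^esub> y) ` A"
      have "x' \<circ> inv\<^bsub>G\<^esub> y' \<in> U"
        if "x' \<in> H" "y' \<in> H" and eq: "\<forall>b\<in>B. x' b = x b" "\<forall>b\<in>B. y' b = y b" for x' y'
      proof -
        have "(x' \<circ> inv\<^bsub>G\<^esub> y') a = (x \<circ> inv\<^bsub>G\<^esub> y) a" if "a \<in> A" for a
        proof -
          have b: "(inv\<^bsub>G\<^esub> y) a \<in> B" using that by (simp add: B_def)
          then have "y' ((inv\<^bsub>G\<^esub> y) a) = a"
            using eq(2) inv_G_apply(2)[OF xy(2)] by simp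
          then have "(inv\<^bsub>G\<^esub> y') a = (inv\<^bsub>G\<^esub> y) a"
            using inv_G_apply(1)[OF \<open>y' \<in> H\<close>] by metis
          then show ?thesis using eq(1) b by simp
        qed
        moreover have "x' \<circ> inv\<^bsub>G\<^esub> y' \<in> H"
          using m_closed[of x' "inv\<^bsub>G\<^esub> y'"] inv_closed[of y'] that by simp
        ultimately show ?thesis using A(2) by blast
      qed
      moreover have "finite B" using A(1) by (simp add: B_def)
      ultimately show "\<exists>V W. openin pointwise V \<and> openin pointwise W \<and> x \<in> V \<and> y \<in> W \<and>
          V \<times> W \<subseteq> {z \<in> topspace (prod_topology pointwise pointwise).
            (case z of (x, y) \<Rightarrow> x \<otimes>\<^bsub>G\<^esub> inv\<^bsub>G\<^esub> y) \<in> U}"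
        using xy by (intro exI[of _ "{h \<in> H. \<forall>b\<in>B. h b = x b}"] exI[of _ "{h \<in> H. \<forall>b\<in>B. h b = y b}"])
          (auto simp: openin_pointwise_agreeing)
    qed
  qed
  moreover have "linear_topology G pointwise"
    unfolding linear_topology_def
  proof (intro allI impI)
    fix U assume "openin pointwise U \<and> \<one>\<^bsub>G\<^esub> \<in> U"
    then obtain A where A: "finite A" "{h \<in> H. \<forall>a\<in>A. h a = id a} \<subseteq> U"
      unfolding openin_pointwise one_G by blast
    have "subgroup {h \<in> H. \<forall>a\<in>A. h a = id a} G"
    proof (rule subgroupI)
      show "inv\<^bsub>G\<^esub> h \<in> {h \<in> H. \<forall>a\<in>A. h a = id a}" if "h \<in> {h \<in> H. \<forall>a\<in>A. h a = id a}" for h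
        using that inv_closed[of h] inv_G_apply(1)[of h] by auto metis
      show "{h \<in> H. \<forall>a\<in>A. h a = id a} \<noteq> {}"
        using one_closed by auto
    qed (use m_closed in \<open>auto simp: comp_def\<close>)
    with A openin_pointwise_agreeing[OF A(1), of id]
    show "\<exists>K. subgroup K G \<and> openin pointwise K \<and> K \<subseteq> U" by blast
  qed
  ultimately show ?thesis
    by (simp add: T_l_def group_topology_def)
qed

text \<open>
  A basic open set consists of the members of \<open>H\<close> that extend a given finite partial map. Since
  members of \<open>H\<close> agree outside \<open>X\<close>, it suffices to take finite subsets of \<open>X \<times> X\<close> as partial maps.
\<close>

lemma small_base_pointwise:
  assumes "infinite X"
  obtains B where "is_base pointwise B" "|B| \<le>o |X|"
proof
  let ?V = "\<lambda>S. {h \<in> H. \<forall>(a, b)\<in>S. h a = b}"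
  show "is_base pointwise (?V ` Fpow (X \<times> X))"
    unfolding is_base_def
  proof (intro conjI ballI allI impI)
    fix V assume "V \<in> ?V ` Fpow (X \<times> X)"
    then obtain S where S: "V = ?V S" "finite S" by (auto simp: Fpow_def)
    have "{h \<in> H. \<forall>a\<in>fst ` S. h a = g a} \<subseteq> V" if "g \<in> V" for g
      using that unfolding S(1) by force
    moreover have "V \<subseteq> H" using S(1) by auto
    ultimately show "openin pointwise V"
      unfolding openin_pointwise using S(2) by (meson finite_imageI)
  next
    fix U g assume "openin pointwise U \<and> g \<in> U"
    then obtain A where g: "g \<in> H" and A: "finite A" "{h \<in> H. \<forall>a\<in>A. h a = g a} \<subseteq> U"
      unfolding openin_pointwise by blast
    define S where "S = (\<lambda>a. (a, g a)) ` (A \<inter> X)"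
    have "S \<in> Fpow (X \<times> X)"
      using A(1) permutes_in_image[OF permutes[OF g]] by (auto simp: S_def Fpow_def)
    moreover have "?V S \<subseteq> U"
    proof
      fix h assume h: "h \<in> ?V S"
      then have "h a = g a" if "a \<in> A" for a
        using that permutes[of h, THEN permutes_not_in] permutes[OF g, THEN permutes_not_in]
        by (cases "a \<in> X") (auto simp: S_def)
      with h A(2) show "h \<in> U" by auto
    qed
    moreover have "g \<in> ?V S"
      using g by (auto simp: S_def)
    ultimately show "\<exists>V\<in>?V ` Fpow (X \<times> X). g \<in> V \<and> V \<subseteq> U"
      by (intro bexI[of _ "?V S"] conjI imageI)
  qed
  have "|?V ` Fpow (X \<times> X)| \<le>o |Fpow (X \<times> X)|"
    by (rule card_of_image)
  also have "|Fpow (X \<times> X)| \<le>o |X|"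
    using assms card_of_Times_same_infinite[OF assms]
    by (intro card_of_Fpow_ordLeq ordIso_imp_ordLeq)
  finally show "|?V ` Fpow (X \<times> X)| \<le>o |X|" .
qed

section \<open>Weak compatibility above the cardinality of the set\<close>

text \<open>
  Choose for any two distinct members of \<open>E\<close> a point at which they differ; the union of the orbits
  of these finitely many points is the required set.
\<close>

lemma finite_faithful_invariant_set:
  assumes E: "subgroup E G" "finite E"
  obtains A where "finite A" "A \<subseteq> X" "\<And>g a. g \<in> E \<Longrightarrow> a \<in> A \<Longrightarrow> g a \<in> A"
    "\<And>g h. g \<in> E \<Longrightarrow> h \<in> E \<Longrightarrow> (\<And>a. a \<in> A \<Longrightarrow> g a = h a) \<Longrightarrow> g = h"
proof -
  have EH: "g \<in> H" if "g \<in> E" for g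
    using subgroup.mem_carrier[OF E(1) that] by simp
  have "\<exists>c\<in>X. g c \<noteq> h c" if "g \<in> E" "h \<in> E" "g \<noteq> h" for g h
    using that EH[THEN permutes, THEN permutes_not_in] by (metis ext)
  then obtain c where c: "\<And>g h. g \<in> E \<Longrightarrow> h \<in> E \<Longrightarrow> g \<noteq> h \<Longrightarrow> c g h \<in> X \<and> g (c g h) \<noteq> h (c g h)"
    by metis
  define C where "C = {c g h | g h. g \<in> E \<and> h \<in> E \<and> g \<noteq> h}"
  define A where "A = (\<lambda>(k, x). k x) ` (E \<times> C)"
  have "C \<subseteq> (\<lambda>(g, h). c g h) ` (E \<times> E)" by (auto simp: C_def)
  then have "finite C" using E(2) by (meson finite_SigmaI finite_imageI finite_subset)
  then have "finite A" using E(2) by (simp add: A_def)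
  moreover have "C \<subseteq> X" using c by (auto simp: C_def)
  then have "A \<subseteq> X"
    using EH[THEN permutes, THEN permutes_in_image] by (auto simp: A_def)
  moreover have "g a \<in> A" if "g \<in> E" "a \<in> A" for g a
  proof -
    from that(2) obtain k x where "k \<in> E" "x \<in> C" "a = k x" by (auto simp: A_def)
    moreover have "g \<circ> k \<in> E"
      using subgroup.m_closed[OF E(1) \<open>g \<in> E\<close> \<open>k \<in> E\<close>] by simp
    ultimately show ?thesis
      unfolding A_def by (intro image_eqI[of _ _ "(g \<circ> k, x)"]) auto
  qed
  moreover have "g = h" if "g \<in> E" "h \<in> E" "\<And>a. a \<in> A \<Longrightarrow> g a = h a" for g h
  proof (rule ccontr)
    assume "g \<noteq> h"
    then have "c g h \<in> C" using that by (auto simp: C_def)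
    moreover have "id \<in> E" using subgroup.one_closed[OF E(1)] by simp
    ultimately have "c g h \<in> A" unfolding A_def by (intro image_eqI[of _ _ "(id, c g h)"]) auto
    with that c \<open>g \<noteq> h\<close> show False by metis
  qed
  ultimately show thesis by (rule that)
qed

text \<open>
  The table of values of \<open>f i\<close> on a finite faithful invariant set \<open>A i\<close> is a finite subset of
  \<open>\<nat> \<times> X \<times> X\<close>. There are only as many such tables as points of \<open>X\<close>, so two of the
  isomorphisms have the same table.
\<close>

lemma weakly_compatible_above:
  fixes r :: "'i rel"
  assumes X: "infinite X" and r: "Card_order r" "|X| <o r"
  shows "weakly_compatible G r"
  unfolding weakly_compatible_def
proof (intro allI impI; elim conjE)
  fix F :: "nat monoid" and E f
  assume F: "group F" "finite (carrier F)"
    and "\<forall>i\<in>Field r. subgroup (E i) G \<and> finite (E i) \<and> f i \<in> iso F (G\<lparr>carrier := E i\<rparr>)"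
  then have E: "\<And>i. i \<in> Field r \<Longrightarrow> subgroup (E i) G" "\<And>i. i \<in> Field r \<Longrightarrow> finite (E i)"
    and f: "\<And>i. i \<in> Field r \<Longrightarrow> f i \<in> iso F (G\<lparr>carrier := E i\<rparr>)"
    by auto
  interpret F: group F by fact
  have fE: "f i x \<in> E i" if "i \<in> Field r" "x \<in> carrier F" for i x
    using f[OF that(1)] that(2) by (auto simp: iso_def hom_def)
  have f_mult: "f i (x \<otimes>\<^bsub>F\<^esub> y) = f i x \<circ> f i y" if "i \<in> Field r" "x \<in> carrier F" "y \<in> carrier F" for i x y
    using f[OF that(1)] that(2,3) by (auto simp: iso_def hom_def)
  have f_inj: "x = y" if "i \<in> Field r" "x \<in> carrier F" "y \<in> carrier F" "f i x = f i y" for i x y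
    using f[OF that(1)] that(2-4) by (auto simp: iso_def bij_betw_def inj_on_def)
  have f_surj: "\<exists>x\<in>carrier F. g = f i x" if "i \<in> Field r" "g \<in> E i" for i g
    using f[OF that(1)] that(2) by (auto simp: iso_def bij_betw_def)
  have "\<exists>A. finite A \<and> A \<subseteq> X \<and> (\<forall>g\<in>E i. \<forall>a\<in>A. g a \<in> A) \<and>
      (\<forall>g\<in>E i. \<forall>h\<in>E i. (\<forall>a\<in>A. g a = h a) \<longrightarrow> g = h)" if "i \<in> Field r" for i
    using finite_faithful_invariant_set[OF E(1,2)[OF that]] by metis
  then obtain A where A: "\<And>i. i \<in> Field r \<Longrightarrow> finite (A i) \<and> A i \<subseteq> X"
    "\<And>i g a. i \<in> Field r \<Longrightarrow> g \<in> E i \<Longrightarrow> a \<in> A i \<Longrightarrow> g a \<in> A i"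
    "\<And>i g h. i \<in> Field r \<Longrightarrow> g \<in> E i \<Longrightarrow> h \<in> E i \<Longrightarrow> \<forall>a\<in>A i. g a = h a \<Longrightarrow> g = h"
    by metis
  define S where "S i = (\<lambda>(x, a). (x, a, f i x a)) ` (carrier F \<times> A i)" for i
  have "S i \<in> Fpow (UNIV \<times> X \<times> X)" if "i \<in> Field r" for i
    using A(1,2)[OF that] fE[OF that] F(2) by (fastforce simp: S_def Fpow_def)
  moreover have "|Fpow ((UNIV :: nat set) \<times> X \<times> X)| \<le>o |X|"
    using X card_of_Times_same_infinite[OF X] infinite_iff_card_of_nat[of X]
    by (intro card_of_Fpow_ordLeq card_of_Times_ordLeq_infinite) (auto intro: ordIso_imp_ordLeq)
  then have "|Fpow ((UNIV :: nat set) \<times> X \<times> X)| <o |Field r|"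
    using r by (meson card_of_Field_ordIso ordIso_symmetric ordLeq_ordLess_trans ordLess_ordIso_trans)
  ultimately have "\<not> inj_on S (Field r)"
    using card_of_ordLeqI[of S "Field r"] not_ordLess_ordLeq by blast
  then obtain i j where ij: "i \<in> Field r" "j \<in> Field r" "i \<noteq> j" "S i = S j"
    by (auto simp: inj_on_def)
  have one: "\<one>\<^bsub>F\<^esub> \<in> carrier F" by simp
  have f_eq: "f i x a = f j x a" if "x \<in> carrier F" "a \<in> A i" for x a
  proof -
    have "(x, a, f i x a) \<in> S i" using that by (force simp: S_def)
    then have "(x, a, f i x a) \<in> S j" by (simp add: ij(4))
    then show ?thesis by (auto simp: S_def)
  qed
  \<comment> \<open>If \<open>g\<close> acts on \<open>A i\<close> like some \<open>f i x\<close>, then \<open>\<phi> g\<close> is this \<open>x\<close>, which is unique because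
    \<open>E i\<close> acts faithfully on \<open>A i\<close>.\<close>
  define \<phi> where "\<phi> g = (SOME x. x \<in> carrier F \<and> (\<forall>a\<in>A i. f i x a = g a))" for g
  have \<phi>: "\<phi> g = x" if "x \<in> carrier F" "\<forall>a\<in>A i. f i x a = g a" for g x
    unfolding \<phi>_def
  proof (rule some_equality)
    fix y assume "y \<in> carrier F \<and> (\<forall>a\<in>A i. f i y a = g a)"
    then show "y = x"
      using that A(3)[OF ij(1) fE[OF ij(1)] fE[OF ij(1)], of y x] f_inj[OF ij(1)] by metis
  qed (use that in blast)
  \<comment> \<open>The permutations that act on \<open>A i\<close> like some \<open>f i x\<close> form a group containing both subgroups,
    and on this group \<open>\<phi>\<close> is multiplicative.\<close>
  define K where "K = {g \<in> H. \<exists>x\<in>carrier F. \<forall>a\<in>A i. f i x a = g a}"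
  have f1: "f i \<one>\<^bsub>F\<^esub> = id"
  proof -
    have "f i \<one>\<^bsub>F\<^esub> \<circ> f i \<one>\<^bsub>F\<^esub> = f i \<one>\<^bsub>F\<^esub>"
      using f_mult[OF ij(1) one one] by simp
    moreover have "bij (f i \<one>\<^bsub>F\<^esub>)"
      using fE[OF ij(1) one] subgroup.mem_carrier[OF E(1)[OF ij(1)]] permutes permutes_bij
      by (metis carrier_G)
    ultimately show ?thesis
      by (metis bij_is_inj ext id_apply injD o_apply)
  qed
  have K_mult: "\<phi> (g \<circ> h) = \<phi> g \<otimes>\<^bsub>F\<^esub> \<phi> h \<and> g \<circ> h \<in> K" if g: "g \<in> K" and h: "h \<in> K" for g h
  proof -
    obtain x y where xy: "x \<in> carrier F" "\<forall>a\<in>A i. f i x a = g a" "y \<in> carrier F" "\<forall>a\<in>A i. f i y a = h a"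
      using g h by (auto simp: K_def)
    have "f i (x \<otimes>\<^bsub>F\<^esub> y) a = (g \<circ> h) a" if "a \<in> A i" for a
      using f_mult[OF ij(1) xy(1,3)] xy A(2)[OF ij(1) fE[OF ij(1) xy(3)] that] that by simp
    moreover have "g \<circ> h \<in> H"
      using g h m_closed[of g h] by (simp add: K_def)
    ultimately show ?thesis
      using \<phi>[of "x \<otimes>\<^bsub>F\<^esub> y" "g \<circ> h"] \<phi>[OF xy(1,2)] \<phi>[OF xy(3,4)] xy(1,3) F.m_closed
      unfolding K_def by blast
  qed
  have "subgroup K G"
  proof (rule subgroupI)
    show "K \<noteq> {}"
    proof -
      have "id \<in> K" using one f1 one_closed by (auto simp: K_def intro!: bexI[of _ "\<one>\<^bsub>F\<^esub>"])
      then show ?thesis by blast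
    qed
    show "inv\<^bsub>G\<^esub> g \<in> K" if g: "g \<in> K" for g
    proof -
      obtain x where x: "x \<in> carrier F" "\<forall>a\<in>A i. f i x a = g a" and gH: "g \<in> H"
        using g by (auto simp: K_def)
      have "f i (inv\<^bsub>F\<^esub> x) a = (inv\<^bsub>G\<^esub> g) a" if a: "a \<in> A i" for a
      proof -
        have b: "f i (inv\<^bsub>F\<^esub> x) a \<in> A i"
          using A(2)[OF ij(1) fE[OF ij(1)] a] x(1) by simp
        have "g (f i (inv\<^bsub>F\<^esub> x) a) = (f i x \<circ> f i (inv\<^bsub>F\<^esub> x)) a"
          using x(2) b by simp
        also have "\<dots> = a"
          using f_mult[OF ij(1) x(1), of "inv\<^bsub>F\<^esub> x"] x(1) f1 by simp
        finally show ?thesis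
          using inv_G_apply(1)[OF gH] by metis
      qed
      then show ?thesis
        using x(1) inv_closed[of g] gH by (auto simp: K_def)
    qed
  qed (use K_mult in \<open>auto simp: K_def\<close>)
  moreover have EK: "E i \<union> E j \<subseteq> K"
    using f_surj[OF ij(1)] f_surj[OF ij(2)] f_eq E(1)[OF ij(1)] E(1)[OF ij(2)]
    by (fastforce simp: K_def dest: subgroup.mem_carrier)
  ultimately have gen_K: "g \<in> K" if "g \<in> generate G (E i \<union> E j)" for g
    using generate_subgroup_incl that by blast
  have "\<phi> \<in> hom (G\<lparr>carrier := generate G (E i \<union> E j)\<rparr>) F"
  proof (rule homI)
    fix g assume "g \<in> carrier (G\<lparr>carrier := generate G (E i \<union> E j)\<rparr>)"
    then obtain x where "x \<in> carrier F" "\<forall>a\<in>A i. f i x a = g a"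
      using gen_K[of g] by (auto simp: K_def)
    then show "\<phi> g \<in> carrier F" using \<phi> by simp
  qed (use K_mult gen_K in simp)
  moreover have "\<forall>x\<in>carrier F. \<phi> (f i x) = x \<and> \<phi> (f j x) = x"
    using \<phi> f_eq by auto
  ultimately have hom: "\<exists>\<phi>\<in>hom (G\<lparr>carrier := generate G (E i \<union> E j)\<rparr>) F.
      \<forall>x\<in>carrier F. \<phi> (f i x) = x \<and> \<phi> (f j x) = x"
    by blast
  have "total_on (Field r) r"
    using r(1) by (simp add: card_order_on_def well_order_on_def linear_order_on_def)
  then have "(i, j) \<in> r \<or> (j, i) \<in> r"
    using ij by (auto simp: total_on_def)
  then show "\<exists>i\<in>Field r. \<exists>j\<in>Field r. (i, j) \<in> r \<and> i \<noteq> j \<and>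
      (\<exists>\<phi>\<in>hom (G\<lparr>carrier := generate G (E i \<union> E j)\<rparr>) F.
         \<forall>x\<in>carrier F. \<phi> (f i x) = x \<and> \<phi> (f j x) = x)"
    using ij hom by (metis Un_commute)
qed

end

section \<open>Three-cycles\<close>

definition cyc3 :: "'a \<Rightarrow> 'a \<Rightarrow> 'a \<Rightarrow> 'a \<Rightarrow> 'a" where
  "cyc3 x y z = Transposition.transpose x y \<circ> Transposition.transpose y z"

lemma cyc3_apply:
  assumes "x \<noteq> y" "y \<noteq> z" "x \<noteq> z"
  shows "cyc3 x y z t = (if t = x then y else if t = y then z else if t = z then x else t)"
  using assms by (auto simp: cyc3_def Transposition.transpose_def)

lemma cyc3_in_Alt:
  assumes "x \<noteq> y" "y \<noteq> z" "{x, y, z} \<subseteq> X"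
  shows "cyc3 x y z \<in> Alt X"
  unfolding Alt_def using assms
  by (intro CollectI exI[of _ "[(x, y), (y, z)]"]) (simp add: cyc3_def)

lemma cyc3_values:
  assumes "x \<noteq> y" "y \<noteq> z" "x \<noteq> z"
  shows "cyc3 x y z x = y" "cyc3 x y z y = z" "cyc3 x y z z = x"
    "t \<noteq> x \<Longrightarrow> t \<noteq> y \<Longrightarrow> t \<noteq> z \<Longrightarrow> cyc3 x y z t = t"
  using assms by (simp_all add: cyc3_apply)

lemma cyc3_rotate:
  assumes "x \<noteq> y" "y \<noteq> z" "x \<noteq> z"
  shows "cyc3 x y z = cyc3 y z x"
  using assms by (auto simp: fun_eq_iff cyc3_apply)

lemma cyc3_cube:
  assumes "x \<noteq> y" "y \<noteq> z" "x \<noteq> z"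
  shows "cyc3 x y z (cyc3 x y z (cyc3 x y z t)) = t"
  using assms by (cases "t \<in> {x, y, z}") (auto simp: cyc3_values)

text \<open>
  The quotient of two members of the family \<open>(p q i)\<close> no longer moves \<open>p\<close>.
\<close>

lemma cyc3_divide:
  assumes "distinct [p, q, i, j]"
  shows "cyc3 p q i \<circ> cyc3 q j i = cyc3 p q j"
proof
  fix t
  from assms have "p \<noteq> q" "p \<noteq> i" "p \<noteq> j" "q \<noteq> i" "q \<noteq> j" "i \<noteq> j" by simp_all
  then show "(cyc3 p q i \<circ> cyc3 q j i) t = cyc3 p q j t"
    by (cases "t \<in> {p, q, i, j}") (auto simp: cyc3_values)
qed

lemma cyc3_conjugate:
  assumes "distinct [p, q, w, i, j]"
  shows "cyc3 q j i \<circ> cyc3 q p w = cyc3 j p w \<circ> cyc3 q j i"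
proof
  fix t
  from assms have "p \<noteq> q" "p \<noteq> w" "p \<noteq> i" "p \<noteq> j" "q \<noteq> w" "q \<noteq> i" "q \<noteq> j" "w \<noteq> i" "w \<noteq> j" "i \<noteq> j"
    by simp_all
  then show "(cyc3 q j i \<circ> cyc3 q p w) t = (cyc3 j p w \<circ> cyc3 q j i) t"
    by (cases "t \<in> {p, q, w, i, j}") (auto simp: cyc3_values)
qed

lemma cyc3_commute:
  assumes "distinct [x, y, z, x', y', z']"
  shows "cyc3 x y z \<circ> cyc3 x' y' z' = cyc3 x' y' z' \<circ> cyc3 x y z"
proof
  fix t
  from assms have "x \<noteq> y" "y \<noteq> z" "x \<noteq> z" "x' \<noteq> y'" "y' \<noteq> z'" "x' \<noteq> z'"
    "x \<noteq> x'" "x \<noteq> y'" "x \<noteq> z'" "y \<noteq> x'" "y \<noteq> y'" "y \<noteq> z'" "z \<noteq> x'" "z \<noteq> y'" "z \<noteq> z'"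
    by simp_all
  then show "(cyc3 x y z \<circ> cyc3 x' y' z') t = (cyc3 x' y' z' \<circ> cyc3 x y z) t"
    by (cases "t \<in> {x, y, z, x', y', z'}") (auto simp: cyc3_values)
qed

lemma cyc3_not_commute:
  assumes "distinct [x, y, z, y', z']"
  shows "cyc3 x y z \<circ> cyc3 x y' z' \<noteq> cyc3 x y' z' \<circ> cyc3 x y z"
proof
  from assms have "x \<noteq> y" "y \<noteq> z" "x \<noteq> z" "x \<noteq> y'" "y' \<noteq> z'" "x \<noteq> z'"
    "y \<noteq> y'" "y \<noteq> z'" "z \<noteq> y'" "z \<noteq> z'"
    by simp_all
  moreover assume "cyc3 x y z \<circ> cyc3 x y' z' = cyc3 x y' z' \<circ> cyc3 x y z"
  then have "cyc3 x y z (cyc3 x y' z' x) = cyc3 x y' z' (cyc3 x y z x)"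
    by (simp add: fun_eq_iff)
  ultimately show False by (simp add: cyc3_values)
qed

text \<open>
  The product is the double transposition \<open>(p i) (q j)\<close>.
\<close>

lemma cyc3_product_involution:
  assumes "distinct [p, q, i, j]"
  shows "(cyc3 p q i \<circ> cyc3 p q j) \<circ> (cyc3 p q i \<circ> cyc3 p q j) = id"
proof
  fix t
  from assms have "p \<noteq> q" "p \<noteq> i" "p \<noteq> j" "q \<noteq> i" "q \<noteq> j" "i \<noteq> j" by simp_all
  then show "((cyc3 p q i \<circ> cyc3 p q j) \<circ> (cyc3 p q i \<circ> cyc3 p q j)) t = id t"
    by (cases "t \<in> {p, q, i, j}") (auto simp: cyc3_values)
qed

section \<open>A large family of three-cycles\<close>

locale alternating_extension = permutation_group +
  fixes p q u v w :: 'a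
  assumes infinite_X: "infinite X" and Alt_subset: "Alt X \<subseteq> H"
    and five_points: "distinct [p, q, u, v, w]" "{p, q, u, v, w} \<subseteq> X"
begin

text \<open>
  The excluded points keep the varying point of the family away from the supports of the auxiliary
  cycles.
\<close>

definition I :: "'a set" where "I = X - {p, q, u, v, w}"

definition D :: "('a \<Rightarrow> 'a) set" where "D = cyc3 p q ` I"

lemma cyc3_in_H:
  assumes "distinct [x, y, z]" "{x, y, z} \<subseteq> X"
  shows "cyc3 x y z \<in> H"
  using assms cyc3_in_Alt[of x y z X] Alt_subset by auto

lemma card_I: "|I| =o |X|"
  unfolding I_def by (rule card_of_infinite_diff_finite[OF infinite_X]) simp

lemma card_D: "|D| =o |X|"
proof -
  have "inj_on (cyc3 p q) I"
  proof (rule inj_onI)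
    fix i j assume "i \<in> I" "j \<in> I" "cyc3 p q i = cyc3 p q j"
    then have "cyc3 p q i q = cyc3 p q j q" by simp
    with \<open>i \<in> I\<close> \<open>j \<in> I\<close> show "i = j"
      using five_points(1) by (auto simp: I_def cyc3_apply split: if_splits)
  qed
  then have "bij_betw (cyc3 p q) I D"
    by (simp add: D_def bij_betw_def)
  then have "|D| =o |I|"
    by (rule ordIso_symmetric[OF card_of_ordIsoI])
  then show ?thesis
    using card_I by (rule ordIso_transitive)
qed

lemma D_subset: "D \<subseteq> H"
  using five_points by (auto simp: D_def I_def intro!: cyc3_in_H)

text \<open>
  A three-cycle \<open>(i v w)\<close> meets the support of \<open>(p q i)\<close> in one point and so does not commute with
  it, but it commutes with every other member of the family.
\<close>

lemma D_discrete:
  assumes "\<tau> \<in> T_s G"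
  shows "subtopology \<tau> D = discrete_topology D"
proof -
  have "\<exists>U. openin \<tau> U \<and> U \<inter> D = {d}" if "d \<in> D" for d
  proof -
    from that obtain i where i: "i \<in> I" "d = cyc3 p q i" by (auto simp: D_def)
    define b where "b = cyc3 i v w"
    define U where "U = {x \<in> H. x \<circ> b \<noteq> b \<circ> x}"
    have "b \<in> H"
      using i(1) five_points by (auto simp: b_def I_def intro!: cyc3_in_H)
    then have "openin \<tau> U"
      using openin_not_commuting[OF is_group assms, of b] by (simp add: U_def)
    moreover have "cyc3 i p q \<circ> b \<noteq> b \<circ> cyc3 i p q"
      unfolding b_def using i(1) five_points(1) by (intro cyc3_not_commute) (auto simp: I_def)
    then have "d \<in> U"
      using i D_subset that five_points(1) cyc3_rotate[of i p q] by (auto simp: U_def I_def)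
    moreover have "cyc3 p q j \<notin> U" if "j \<in> I" "j \<noteq> i" for j
      using cyc3_commute[of p q j i v w] i(1) that five_points(1) by (auto simp: U_def b_def I_def)
    ultimately show ?thesis
      using i that by (intro exI[of _ U]) (auto simp: D_def)
  qed
  then show ?thesis
    using assms D_subset by (subst discrete_subspace_iff) (auto simp: T_s_def shift_invariant_def)
qed

text \<open>
  The supports of \<open>a = (q u v)\<close> and \<open>b = (q p w)\<close> meet in \<open>q\<close> only. A quotient \<open>(q j i)\<close> of two
  members of the family moves \<open>q\<close> to the new point \<open>j\<close> and fixes \<open>p\<close> and \<open>w\<close>, so it conjugates
  \<open>b\<close> to a cycle that is disjoint from \<open>a\<close>.
\<close>

lemma D_uniformly_discrete:
  assumes "\<tau> \<in> T_c G"
  shows "uniformly_discrete G \<tau> D"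
proof -
  define a where "a = cyc3 q u v"
  define b where "b = cyc3 q p w"
  have ab: "a \<in> H" "b \<in> H"
    using five_points by (auto simp: a_def b_def intro!: cyc3_in_H)
  define U where "U = {x \<in> H. x \<circ> b \<circ> inv\<^bsub>G\<^esub> x \<circ> a \<noteq> a \<circ> (x \<circ> b \<circ> inv\<^bsub>G\<^esub> x)}"
  have "openin \<tau> U"
    using openin_conjugate_not_commuting[OF is_group assms, of a b] ab by (simp add: U_def)
  moreover have "\<one>\<^bsub>G\<^esub> \<in> U"
  proof -
    have "b \<circ> a \<noteq> a \<circ> b"
      unfolding a_def b_def using five_points(1) by (intro cyc3_not_commute) auto
    then show ?thesis
      using one_closed inv_one by (simp add: U_def)
  qed
  moreover have "cyc3 p q j \<notin> cyc3 p q i <#\<^bsub>G\<^esub> U" if ij: "i \<in> I" "j \<in> I" "i \<noteq> j" for i j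
  proof
    assume "cyc3 p q j \<in> cyc3 p q i <#\<^bsub>G\<^esub> U"
    then obtain x where x: "x \<in> U" "cyc3 p q j = cyc3 p q i \<circ> x"
      by (auto simp: l_coset_def)
    then have xH: "x \<in> H" by (simp add: U_def)
    have d: "cyc3 p q i \<in> H"
      using ij five_points by (auto simp: I_def intro!: cyc3_in_H)
    have "cyc3 p q i \<circ> x = cyc3 p q i \<circ> cyc3 q j i"
      using cyc3_divide[of p q i j] ij five_points(1) x(2) by (auto simp: I_def)
    then have x_eq: "x = cyc3 q j i"
      by (simp add: fun_eq_iff inj_eq[OF permutes_inj[OF permutes[OF d]]])
    have "x \<circ> b = cyc3 j p w \<circ> x"
      unfolding x_eq b_def using ij five_points(1) by (intro cyc3_conjugate) (auto simp: I_def)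
    then have "x \<circ> b \<circ> inv\<^bsub>G\<^esub> x = cyc3 j p w \<circ> (x \<circ> inv\<^bsub>G\<^esub> x)"
      by (simp add: comp_assoc)
    also have "x \<circ> inv\<^bsub>G\<^esub> x = id"
      using r_inv[of x] xH by simp
    finally have "x \<circ> b \<circ> inv\<^bsub>G\<^esub> x = cyc3 j p w"
      unfolding comp_id .
    moreover have "cyc3 j p w \<circ> a = a \<circ> cyc3 j p w"
      unfolding a_def using ij five_points(1) by (intro cyc3_commute) (auto simp: I_def)
    ultimately show False
      using x(1) by (simp add: U_def)
  qed
  ultimately show ?thesis
    unfolding uniformly_discrete_def D_def by blast
qed

text \<open>
  The subgroups generated by the three-cycles \<open>c\<^sub>i = (p q i)\<close> are isomorphic to \<open>\<int>/3\<close>. A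
  homomorphism \<open>\<phi>\<close> with \<open>\<phi>(c\<^sub>i) = \<phi>(c\<^sub>j) = 1\<close> would map \<open>(c\<^sub>i c\<^sub>j)\<^sup>2\<close> to \<open>4 mod 3 = 1\<close>; but this
  square is the identity.
\<close>

lemma not_weakly_compatible_below:
  fixes r :: "'i rel"
  assumes r: "Card_order r" "r \<le>o |X|"
  shows "\<not> weakly_compatible G r"
proof
  assume wc: "weakly_compatible G r"
  have "|Field r| \<le>o |I|"
    by (rule ordLeq_ordIso_trans[OF ordIso_ordLeq_trans[OF card_of_Field_ordIso[OF r(1)] r(2)]
          ordIso_symmetric[OF card_I]])
  then obtain e where e: "inj_on e (Field r)" "e ` Field r \<subseteq> I"
    unfolding card_of_ordLeq[symmetric] by blast
  let ?F = "integer_mod_group 3"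
  have F: "carrier ?F = {0, 1, 2}"
    by (auto simp: carrier_integer_mod_group)
  define c where "c i = cyc3 p q (e i)" for i
  define f where "f i x = (if x = 0 then id else if x = 1 then c i else c i \<circ> c i)" for i and x :: int
  have dist: "distinct [p, q, e i]" if "i \<in> Field r" for i
    using e(2) that five_points(1) by (auto simp: I_def)
  have cH: "c i \<in> H" if "i \<in> Field r" for i
    using D_subset e(2) that by (auto simp: c_def D_def)
  have cube: "c i (c i (c i t)) = t" if "i \<in> Field r" for i t
    using dist[OF that] by (simp add: c_def cyc3_cube)
  have f_hom: "f i \<in> hom ?F G" if i: "i \<in> Field r" for i
  proof (rule homI)
    show "f i x \<in> carrier G" if "x \<in> carrier ?F" for x
      using cH[OF i] m_closed[of "c i" "c i"] one_closed by (simp add: f_def)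
    show "f i (x \<otimes>\<^bsub>?F\<^esub> y) = f i x \<otimes>\<^bsub>G\<^esub> f i y" if "x \<in> carrier ?F" "y \<in> carrier ?F" for x y
      using that unfolding F by (elim insertE emptyE; simp add: f_def fun_eq_iff cube[OF i])
  qed
  have f_inj: "inj_on (f i) (carrier ?F)" if i: "i \<in> Field r" for i
  proof -
    have "f i 0 p = p" "f i 1 p = q" "f i 2 p = e i"
      using dist[OF i] by (simp_all add: f_def c_def cyc3_values)
    then have "inj_on (\<lambda>x. f i x p) (carrier ?F)"
      using dist[OF i] by (auto simp: F)
    from inj_onD[OF this] show ?thesis
      by (intro inj_onI) simp
  qed
  define E where "E i = f i ` carrier ?F" for i
  have "subgroup (E i) G \<and> finite (E i) \<and> f i \<in> iso ?F (G\<lparr>carrier := E i\<rparr>)" if i: "i \<in> Field r" for i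
  proof (intro conjI)
    interpret group_hom ?F G "f i"
      using f_hom[OF i] by (intro group_hom.intro group_hom_axioms.intro) (simp_all add: is_group)
    show "subgroup (E i) G"
      unfolding E_def by (rule img_is_subgroup)
    show "finite (E i)" by (simp add: E_def F)
    show "f i \<in> iso ?F (G\<lparr>carrier := E i\<rparr>)"
      using f_hom[OF i] f_inj[OF i] by (simp add: iso_def hom_def E_def bij_betw_def image_subset_iff_funcset)
  qed
  with weakly_compatibleD[OF wc, of ?F E f] F obtain i j \<phi> where
    ij: "i \<in> Field r" "j \<in> Field r" "i \<noteq> j"
    and \<phi>: "\<phi> \<in> hom (G\<lparr>carrier := generate G (E i \<union> E j)\<rparr>) ?F"
    and \<phi>_f: "\<And>x. x \<in> carrier ?F \<Longrightarrow> \<phi> (f i x) = x \<and> \<phi> (f j x) = x"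
    by auto
  let ?gen = "generate G (E i \<union> E j)"
  have \<phi>_comp: "\<phi> (g \<circ> h) = (\<phi> g + \<phi> h) mod 3" if "g \<in> ?gen" "h \<in> ?gen" for g h
    using \<phi> that by (simp add: hom_def)
  have c: "c i \<in> ?gen" "c j \<in> ?gen"
  proof -
    have "f i 1 \<in> E i" "f j 1 \<in> E j" by (simp_all add: E_def F)
    then show "c i \<in> ?gen" "c j \<in> ?gen"
      by (auto simp: f_def intro: generate.incl)
  qed
  then have cc: "c i \<circ> c j \<in> ?gen"
    using generate.eng[OF c] by simp
  have "\<phi> (c i) = 1" "\<phi> (c j) = 1" "\<phi> id = 0"
    using \<phi>_f[of 1] \<phi>_f[of 0] by (auto simp: F f_def)
  then have "\<phi> ((c i \<circ> c j) \<circ> (c i \<circ> c j)) = 1"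
    using \<phi>_comp[OF c] \<phi>_comp[OF cc cc] by simp
  moreover have "e i \<noteq> e j"
    using e(1) ij by (auto simp: inj_on_def)
  then have "(c i \<circ> c j) \<circ> (c i \<circ> c j) = id"
    unfolding c_def using dist ij by (intro cyc3_product_involution) auto
  ultimately show False
    using \<open>\<phi> id = 0\<close> by simp
qed

section \<open>The cardinal invariants\<close>

lemma T_l_subset: "T_l G \<subseteq> T_s G"
  using T_l_subset_T_c[OF is_group] T_c_subset_T_s by blast

lemma topspace_T_s: "\<tau> \<in> T_s G \<Longrightarrow> topspace \<tau> = H"
  by (simp add: T_s_def shift_invariant_def)

lemma pointwise_discrete_small:
  assumes "A \<subseteq> H" "subtopology pointwise A = discrete_topology A"
  shows "|A| \<le>o |X|"
proof -
  obtain B where B: "is_base pointwise B" "|B| \<le>o |X|"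
    using small_base_pointwise[OF infinite_X] .
  have "|A| \<le>o |B|"
    using B(1) assms by (intro discrete_subspace_ordLeq_base) simp_all
  then show ?thesis
    using B(2) by (rule ordLeq_transitive)
qed

lemma ordLeq_card_D: "|D| \<le>o r \<Longrightarrow> |X| \<le>o r"
  using ordIso_ordLeq_trans[OF ordIso_symmetric[OF card_D]] .

lemma s_s_eq: "|X| =o s_s G"
proof -
  let ?\<D> = "\<lambda>\<tau>. {A. A \<subseteq> topspace \<tau> \<and> subtopology \<tau> A = discrete_topology A}"
  have spread: "spread \<tau> = Csup {|A| | A. A \<in> ?\<D> \<tau>}" for \<tau> :: "('a \<Rightarrow> 'a) topology"
    by (simp add: spread_def)
  have D: "D \<in> ?\<D> \<tau>" if "\<tau> \<in> T_s G" for \<tau>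
    using D_discrete[OF that] D_subset topspace_T_s[OF that] by simp
  have pointwise: "pointwise \<in> T_s G"
    using pointwise_in_T_l T_l_subset by blast
  show ?thesis
    unfolding s_s_def
  proof (rule Cmin_ordIso)
    show "spread pointwise \<in> {spread \<tau> | \<tau>. \<tau> \<in> T_s G}"
      using pointwise by blast
    show "spread pointwise \<le>o |X|"
      unfolding spread using D[OF pointwise] card_D
      by (rule Csup_card_ordLeq) (simp add: pointwise_discrete_small)
    fix r assume "r \<in> {spread \<tau> | \<tau>. \<tau> \<in> T_s G}"
    then obtain \<tau> where \<tau>: "r = spread \<tau>" "\<tau> \<in> T_s G" by blast
    show "|X| \<le>o r"
      unfolding \<tau>(1) spread using D[OF \<tau>(2)] by (intro ordLeq_card_D ordLeq_Csup_card)
    show "Card_order r"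
      unfolding \<tau>(1) spread by (rule Card_order_Csup_card)
  qed
qed

lemma u_c_eq: "|X| =o u_c G"
proof -
  let ?\<D> = "\<lambda>\<tau>. {A. A \<subseteq> carrier G \<and> uniformly_discrete G \<tau> A}"
  have spread: "uniform_spread G \<tau> = Csup {|A| | A. A \<in> ?\<D> \<tau>}" for \<tau>
    by (simp add: uniform_spread_def)
  have D: "D \<in> ?\<D> \<tau>" if "\<tau> \<in> T_c G" for \<tau>
    using D_uniformly_discrete[OF that] D_subset by simp
  have pointwise: "pointwise \<in> T_c G" "shift_invariant G pointwise"
    using pointwise_in_T_l T_l_subset_T_c[OF is_group] by (auto simp: T_c_def)
  show ?thesis
    unfolding u_c_def
  proof (rule Cmin_ordIso)
    show "uniform_spread G pointwise \<in> {uniform_spread G \<tau> | \<tau>. \<tau> \<in> T_c G}"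
      using pointwise(1) by blast
    show "uniform_spread G pointwise \<le>o |X|"
      unfolding spread using D[OF pointwise(1)] card_D
    proof (rule Csup_card_ordLeq)
      fix A assume "A \<in> ?\<D> pointwise"
      then show "|A| \<le>o |X|"
        using uniformly_discrete_imp_discrete[OF is_group pointwise(2)]
        by (simp add: pointwise_discrete_small)
    qed
    fix r assume "r \<in> {uniform_spread G \<tau> | \<tau>. \<tau> \<in> T_c G}"
    then obtain \<tau> where \<tau>: "r = uniform_spread G \<tau>" "\<tau> \<in> T_c G" by blast
    show "|X| \<le>o r"
      unfolding \<tau>(1) spread using D[OF \<tau>(2)] by (intro ordLeq_card_D ordLeq_Csup_card)
    show "Card_order r"
      unfolding \<tau>(1) spread by (rule Card_order_Csup_card)
  qed
qed

lemma w_l_eq: "|X| =o w_l G"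
proof -
  have weight: "\<exists>C. is_base \<tau> C \<and> weight \<tau> = |C|" "is_base \<tau> B \<Longrightarrow> weight \<tau> \<le>o |B|"
    for \<tau> :: "('a \<Rightarrow> 'a) topology" and B
  proof -
    let ?W = "{|C| | C. is_base \<tau> C}"
    have "is_base \<tau> {U. openin \<tau> U}"
      unfolding is_base_def by blast
    then have ne: "?W \<noteq> {}" by blast
    have card: "Card_order r" if "r \<in> ?W" for r
      using that by (auto simp: card_of_Card_order)
    show "\<exists>C. is_base \<tau> C \<and> weight \<tau> = |C|"
      using Cmin_is_minimum(1)[OF ne card] by (auto simp: weight_def)
    show "weight \<tau> \<le>o |B|" if "is_base \<tau> B"
      unfolding weight_def using that by (intro Cmin_is_minimum(2)[OF ne card]) auto
  qed
  obtain B where B: "is_base pointwise B" "|B| \<le>o |X|"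
    using small_base_pointwise[OF infinite_X] .
  show ?thesis
    unfolding w_l_def
  proof (rule Cmin_ordIso)
    show "weight pointwise \<in> {weight \<tau> | \<tau>. \<tau> \<in> T_l G}"
      using pointwise_in_T_l by blast
    show "weight pointwise \<le>o |X|"
      using weight(2)[OF B(1)] B(2) by (rule ordLeq_transitive)
    fix r assume "r \<in> {weight \<tau> | \<tau>. \<tau> \<in> T_l G}"
    then obtain \<tau> where \<tau>: "r = weight \<tau>" "\<tau> \<in> T_s G"
      using T_l_subset by blast
    then obtain C where C: "is_base \<tau> C" "r = |C|"
      using weight(1)[of \<tau>] by auto
    show "Card_order r"
      unfolding C(2) by (rule card_of_Card_order)
    show "|X| \<le>o r"
      unfolding C(2) using C(1) D_subset D_discrete[OF \<tau>(2)] topspace_T_s[OF \<tau>(2)]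
      by (intro ordLeq_card_D discrete_subspace_ordLeq_base) simp_all
  qed
qed

text \<open>
  The least \<open>\<mu>\<close> is attained at a copy of \<open>|X|\<close> on the type of group elements plus naturals. If
  \<open>r\<close> is smaller than \<open>|X|\<close>, then its successor is still at most \<open>|X|\<close>, and weak compatibility
  fails.
\<close>

lemma cn_eq: "|X| =o cn G"
  unfolding cn_def
proof (rule Cmin_ordIso)
  \<comment> \<open>The family \<open>D\<close> provides a cardinal of size \<open>|X|\<close> on the type over which the minimum ranges.\<close>
  define \<mu> :: "(('a \<Rightarrow> 'a) + nat) rel" where "\<mu> = |Inl ` D|"
  have "bij_betw Inl D (Inl ` D :: (('a \<Rightarrow> 'a) + nat) set)"
    by (simp add: bij_betw_def)
  then have \<mu>_D: "\<mu> =o |D|"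
    unfolding \<mu>_def by (rule ordIso_symmetric[OF card_of_ordIsoI])
  then have \<mu>_X: "\<mu> =o |X|"
    using card_D by (rule ordIso_transitive)
  have "infinite D"
    using card_of_ordIso_finite[OF card_D] infinite_X by simp
  then have \<mu>: "Cinfinite \<mu>"
    by (simp add: \<mu>_def cinfinite_def finite_image_iff Field_card_of card_of_Card_order)
  then have \<mu>': "Card_order \<mu>" "Card_order (cardSuc \<mu>)"
    by (simp_all add: cardSuc_Card_order)
  have "|X| <o cardSuc \<mu>"
    using ordIso_ordLess_trans[OF ordIso_symmetric[OF \<mu>_X] cardSuc_greater[OF \<mu>'(1)]] .
  then show "\<mu> \<in> {\<mu>. Cinfinite \<mu> \<and> weakly_compatible G (cardSuc \<mu>)}"
    using weakly_compatible_above[OF infinite_X \<mu>'(2)] \<mu> by simp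
  show "\<mu> \<le>o |X|"
    using \<mu>_X by (rule ordIso_imp_ordLeq)
  fix r :: "(('a \<Rightarrow> 'a) + nat) rel"
  assume "r \<in> {\<mu>. Cinfinite \<mu> \<and> weakly_compatible G (cardSuc \<mu>)}"
  then have r: "Card_order r" "weakly_compatible G (cardSuc r)" by auto
  show "Card_order r" by (rule r(1))
  show "|X| \<le>o r"
  proof (rule ccontr)
    assume "\<not> |X| \<le>o r"
    then have "r <o |X|"
      using not_ordLeq_iff_ordLess[OF card_order_on_well_order_on[OF r(1)] card_of_Well_order[of X]] by simp
    then have "cardSuc r \<le>o |X|"
      by (rule cardSuc_least[OF r(1) card_of_Card_order])
    then show False
      using not_weakly_compatible_below[OF cardSuc_Card_order[OF r(1)]] r(2) by blast
  qed
qed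

end

theorem theorem2:
  fixes \<kappa> :: "'a rel" and H :: "('a \<Rightarrow> 'a) set" and G :: "('a \<Rightarrow> 'a) monoid"
  assumes "Cinfinite \<kappa>"
    and "subgroup H (Sym (Field \<kappa>))"
    and "Alt (Field \<kappa>) \<subseteq> H"
    and "G = (Sym (Field \<kappa>))\<lparr>carrier := H\<rparr>"
  shows "\<kappa> =o s_s G \<and> \<kappa> =o u_c G \<and> \<kappa> =o w_l G \<and> \<kappa> =o cn G"
proof -
  have infinite: "infinite (Field \<kappa>)"
    using assms(1) by (simp add: cinfinite_def)
  have \<kappa>: "\<kappa> =o |Field \<kappa>|"
    using assms(1) by (rule ordIso_symmetric[OF card_of_Field_ordIso, OF conjunct2])
  \<comment> \<open>The family of three-cycles needs \<open>p\<close> and \<open>q\<close>; the other three points are for the cycles that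
    separate its members.\<close>
  obtain A where "finite A" "card A = 5" "A \<subseteq> Field \<kappa>"
    using infinite_arbitrarily_large[OF infinite, of 5] by (elim exE conjE)
  moreover from \<open>finite A\<close> obtain xs where "set xs = A" "distinct xs"
    using finite_distinct_list by blast
  ultimately have xs: "length xs = Suc (Suc (Suc (Suc (Suc 0))))" "distinct xs" "set xs \<subseteq> Field \<kappa>"
    using distinct_card[of xs] by simp_all
  from xs(1) obtain p q u v w where "xs = [p, q, u, v, w]"
    unfolding length_Suc_conv length_0_conv by blast
  with xs(2,3) have "distinct [p, q, u, v, w]" "{p, q, u, v, w} \<subseteq> Field \<kappa>"
    by simp_all
  then interpret alternating_extension "Field \<kappa>" H p q u v w
    by (intro alternating_extension.intro permutation_group.intro alternating_extension_axioms.intro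
        assms(2,3) infinite)
  show ?thesis
    unfolding assms(4)
    using s_s_eq u_c_eq w_l_eq cn_eq by (intro conjI ordIso_transitive[OF \<kappa>])
qed

end
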